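(* Fix a quantile level $\tau\in(0,1)$. For each sample size $n$ let $Y_1,\dots,Y_n$ follow the piecewise constant model with $K^*\in\mathbb{N}$ change-points $1<t_1^*<\dots<t_{K^*}^*<n$, phase values $\mu_1^*,\dots,\mu_{K^*+1}^*$ satisfying $\mu_k^*\neq\mu_{k+1}^*$ for $k=1,\dots,K^*$, and errors $\varepsilon_t$, and let $\widehat{\mathcal A}_n$ be the set of change-point locations estimated by the quantile LASSO with regularization parameter $\lambda_n>0$ (model and estimator as defined in the context). Assume: (i) the values $\mu_k^*\in\mathbb{R}$, $k=1,\dots,K^*+1$, do not depend on $n$; (ii) the errors $\varepsilon_i$ are i.i.d. with an absolutely continuous distribution function $F$ such that $\mathbb{P}[\varepsilon_i<0]=\tau$, whose density $f$ satisfies $f(x)>0$ for all $x\in\mathbb{R}$ and is continuously differentiable with $|f'(x)|<\infty$; (iii) $I_{\min}^*:=\min_{1\le k\le K^*}(t_{k+1}^*-t_k^* )\ge n\delta_n$ for a decreasing positive sequence $(\delta_n)$ with $\delta_n\to0$ as $n\to\infty$; (iv) $\lambda_n/\delta_n\to0$ as $n\to\infty$; (v) $K^*$ is fixed and does not depend on $n$; (vi) $\lambda_n=C(n^{-1}\log n)^{1/2}$ for some constant $C>0$; (vii) $t_k^*/n\to\tau_k^*$ as $n\to\infty$ for $k=1,\dots,K^*$, where $0<\tau_1^*<\dots<\tau_{K^*}^*<1$ are fixed. Then $$\mathbb{P}\big[|\widehat{\mathcal A}_n|<K^*\big]\to0\qquad\text{as } n\to\infty.$$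
   Context: Model. With the conventions $t_0^*=1$ and $t_{K^*+1}^*=n+1$, the observations are $Y_t=\mu_k^*+\varepsilon_t$ for $t_{k-1}^*\le t\le t_k^*-1$, $k=1,\dots,K^*+1$ (so $t=1,\dots,n$). The change-point locations $t_k^*$ may depend on $n$. Estimator. Let $\rho_\tau(v)=v\,(\tau-\mathbf{1}\{v<0\})$ for $v\in\mathbb{R}$. Let $\mathbb{X}_n$ be the $n\times n$ lower triangular matrix whose entries on and below the diagonal are all equal to $1$ (and $0$ above), so that $(\mathbb{X}_n\beta)_i=\sum_{j=1}^i\beta_j$. The quantile LASSO estimator is a solution $$\widehat{\beta}^n=(\widehat\beta_1,\dots,\widehat\beta_n)^\top\in\operatorname*{arg\,min}_{\beta\in\mathbb{R}^n}\Big[\sum_{i=1}^n\rho_\tau\big(Y_i-(\mathbb{X}_n\beta)_i\big)+n\lambda_n\sum_{i=2}^n|\beta_i|\Big].$$ The set of estimated change-point locations is $\widehat{\mathcal A}_n=\{i\in\{2,\dots,n\}:\widehat\beta_i\neq0\}$, and $|\widehat{\mathcal A}_n|$ is its cardinality. *)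

theory Defs
  imports "HOL-Probability.Probability"
begin

(* Vectors of R^n are functions nat => real whose coordinates 1, ..., n are used;
   the values at all other indices are irrelevant. *)

definition check_loss :: "real \<Rightarrow> real \<Rightarrow> real" where
  "check_loss \<tau> v = v * (\<tau> - of_bool (v < 0))"

definition design_matrix :: "nat \<Rightarrow> nat \<Rightarrow> real" where
  "design_matrix i j = (if j \<le> i then 1 else 0)"

definition fitted :: "nat \<Rightarrow> (nat \<Rightarrow> real) \<Rightarrow> nat \<Rightarrow> real" where
  "fitted n \<beta> i = (\<Sum>j=1..n. design_matrix i j * \<beta> j)"

lemma fitted_eq_partial_sum:
  assumes "i \<le> n"
  shows "fitted n \<beta> i = (\<Sum>j=1..i. \<beta> j)"
proof -
  have "fitted n \<beta> i = (\<Sum>j=1..n. if j \<le> i then \<beta> j else 0)"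
    unfolding fitted_def design_matrix_def by (intro sum.cong) auto
  also have "\<dots> = (\<Sum>j\<in>{j\<in>{1..n}. j \<le> i}. \<beta> j)"
    by (rule sum.inter_filter[symmetric]) simp
  also have "{j\<in>{1..n}. j \<le> i} = {1..i}"
    using assms by auto
  finally show ?thesis .
qed

definition qlasso_objective ::
    "real \<Rightarrow> nat \<Rightarrow> real \<Rightarrow> (nat \<Rightarrow> real) \<Rightarrow> (nat \<Rightarrow> real) \<Rightarrow> real" where
  "qlasso_objective \<tau> n l y \<beta> =
     (\<Sum>i=1..n. check_loss \<tau> (y i - fitted n \<beta> i)) + real n * l * (\<Sum>i=2..n. \<bar>\<beta> i\<bar>)"

(* A solution need not be unique; this is membership in the arg min. *)
definition qlasso_solution ::
    "real \<Rightarrow> nat \<Rightarrow> real \<Rightarrow> (nat \<Rightarrow> real) \<Rightarrow> (nat \<Rightarrow> real) \<Rightarrow> bool" where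
  "qlasso_solution \<tau> n l y \<beta> \<longleftrightarrow> is_arg_min (qlasso_objective \<tau> n l y) (\<lambda>_. True) \<beta>"

definition estimated_change_points :: "nat \<Rightarrow> (nat \<Rightarrow> real) \<Rightarrow> nat set" where
  "estimated_change_points n \<beta> = {i \<in> {2..n}. \<beta> i \<noteq> 0}"

(* t 0 = 1 and t (K + 1) = n + 1 are the boundary conventions, so that
   strict monotonicity on {0..K} includes 1 < t 1. *)
definition change_point_locations :: "nat \<Rightarrow> nat \<Rightarrow> (nat \<Rightarrow> nat) \<Rightarrow> bool" where
  "change_point_locations K n t \<longleftrightarrow>
     t 0 = 1 \<and> t (K + 1) = n + 1 \<and> strict_mono_on {0..K} t \<and> t K < n"

(* The first phase, from t 0 to t 1, is not part of the minimum. Meaningful for K \<ge> 1. *)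
definition min_phase_length :: "nat \<Rightarrow> (nat \<Rightarrow> nat) \<Rightarrow> real" where
  "min_phase_length K t = Min ((\<lambda>k. real (t (k + 1)) - real (t k)) ` {1..K})"

definition piecewise_constant_model ::
    "nat \<Rightarrow> (nat \<Rightarrow> nat) \<Rightarrow> (nat \<Rightarrow> real) \<Rightarrow> (nat \<Rightarrow> real) \<Rightarrow> (nat \<Rightarrow> real) \<Rightarrow> bool" where
  "piecewise_constant_model K t \<mu> e y \<longleftrightarrow>
     (\<forall>k\<in>{1..K+1}. \<forall>i\<in>{t (k - 1)..<t k}. y i = \<mu> k + e i)"

(* The derivative f' is real-valued, so |f' x| < \<infinity> holds at every x;
   f' is not assumed to be bounded. *)
definition error_density :: "(real \<Rightarrow> real) \<Rightarrow> bool" where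
  "error_density f \<longleftrightarrow> (\<forall>x. f x > 0) \<and>
     (\<exists>f'. (\<forall>x. (f has_real_derivative f' x) (at x)) \<and> continuous_on UNIV f')"

definition iid_errors ::
    "'a measure \<Rightarrow> real \<Rightarrow> (real \<Rightarrow> real) \<Rightarrow> nat \<Rightarrow> (nat \<Rightarrow> 'a \<Rightarrow> real) \<Rightarrow> bool" where
  "iid_errors M \<tau> f n e \<longleftrightarrow>
     prob_space.indep_vars M (\<lambda>_. borel) e {1..n} \<and>
     (\<forall>i\<in>{1..n}. distributed M lborel (e i) (\<lambda>x. ennreal (f x)) \<and>
                 measure M {\<omega> \<in> space M. e i \<omega> < 0} = \<tau>)"

end

theory Submission
  imports Defs
begin

text \<open>
If the estimator selects fewer than \<open>K\<close> locations, then by the pigeonhole principle one of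
\<open>K\<close> disjoint neighbourhoods \<open>(t\<^sub>k - m, t\<^sub>k + m)\<close> of the true change-points contains none of them, so
the fit is a constant \<open>c\<close> on the two windows of length \<open>m\<close> to the left and to the right of
\<open>t\<^sub>k\<close>. As the limits of \<open>t\<^sub>k / n\<close> are distinct and lie strictly between 0 and 1, the half-width can be
taken to be \<open>m = \<lfloor>\<kappa> n\<rfloor>\<close> with a fixed \<open>\<kappa> > 0\<close>.

Since the two phases meeting at \<open>t\<^sub>k\<close> differ by at least some \<open>4 \<eta> > 0\<close>, the constant \<open>c\<close> misses the
value of at least one of them by \<open>2 \<eta>\<close> or more. On the other hand, optimality forces \<open>c\<close> to be nearly
a \<open>\<tau>\<close>-quantile of the observations on either window: moving the fit on a window up or down costs
at most two jumps in the penalty, so the fraction of observations below \<open>c\<close> is \<open>\<tau>\<close> up to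
\<open>2 n \<lambda>\<^sub>n / m\<close>, which tends to 0 (\<open>qlasso_block_counts\<close>; the move has the finite size \<open>\<eta>\<close>,
and the counts are taken at \<open>c + \<eta>\<close> and \<open>c - \<eta>\<close>). Hence on one of the windows, up to this
tolerance, at most a fraction \<open>\<tau>\<close> of the errors lies below \<open>\<eta>\<close>, or at least a fraction \<open>\<tau>\<close> of them
lies below \<open>- \<eta>\<close> (\<open>deviates_if_too_few_change_points\<close>).

Both events are large deviations. The density is positive, so the probabilities that an error is
below \<open>\<eta>\<close> and below \<open>- \<eta>\<close> lie strictly above and strictly below \<open>\<tau>\<close>, and Hoeffding's
inequality bounds the probability of each event by \<open>exp (- 2 s\<^sup>2 m)\<close> for a fixed \<open>s > 0\<close>
(\<open>prob_deviates_le\<close>). Only \<open>2 K\<close> windows are involved, and they are determined by the true change-points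
rather than by the estimate, so a union bound finishes the proof.
\<close>

section \<open>Optimality of the estimator\<close>

text \<open>
The loss has slope \<open>\<tau>\<close> on the positive and \<open>\<tau> - 1\<close> on the negative half-line. Using the worst
slope where the shift crosses the kink keeps the bounds valid for shifts of every size, so no
directional derivative, and no special treatment of residuals equal to 0, is required.
\<close>

lemma check_loss_shift_up:
  assumes "h > 0"
  shows "check_loss \<tau> (v - h) - check_loss \<tau> v \<le> h * (of_bool (v < h) - \<tau>)"
  using assms by (auto simp: check_loss_def algebra_simps)

lemma check_loss_shift_down:
  assumes "h > 0"
  shows "check_loss \<tau> (v + h) - check_loss \<tau> v \<le> h * (\<tau> - of_bool (v < - h))"
  using assms by (auto simp: check_loss_def algebra_simps)

text \<open>
In terms of the increments \<open>\<beta>\<close>, adding \<open>h\<close> to the fit on \<open>{a..<b}\<close> means changing just two of them. For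
\<open>b = n + 1\<close> the second change falls outside the coordinates that count, which is why a block
may extend to the last observation.
\<close>

definition shift_block :: "nat \<Rightarrow> nat \<Rightarrow> real \<Rightarrow> (nat \<Rightarrow> real) \<Rightarrow> nat \<Rightarrow> real" where
  "shift_block a b h \<beta> j = \<beta> j + (if j = a then h else 0) - (if j = b then h else 0)"

lemma fitted_shift_block:
  assumes "1 \<le> a" "a < b" "i \<le> n"
  shows "fitted n (shift_block a b h \<beta>) i = fitted n \<beta> i + (if i \<in> {a..<b} then h else 0)"
  using assms
  by (simp add: fitted_eq_partial_sum shift_block_def sum.distrib sum_subtractf)

lemma sum_abs_shift_block_le:
  "(\<Sum>j=2..n. \<bar>shift_block a b h \<beta> j\<bar>) \<le> (\<Sum>j=2..n. \<bar>\<beta> j\<bar>) + 2 * \<bar>h\<bar>"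
proof -
  have "(\<Sum>j=2..n. \<bar>shift_block a b h \<beta> j\<bar>)
      \<le> (\<Sum>j=2..n. \<bar>\<beta> j\<bar> + (if j = a then \<bar>h\<bar> else 0) + (if j = b then \<bar>h\<bar> else 0))"
    by (intro sum_mono) (auto simp: shift_block_def)
  also have "\<dots> \<le> (\<Sum>j=2..n. \<bar>\<beta> j\<bar>) + 2 * \<bar>h\<bar>"
    by (auto simp: sum.distrib)
  finally show ?thesis .
qed

lemma qlasso_block_optimality:
  assumes sol: "qlasso_solution \<tau> n l y \<beta>" and l: "l \<ge> 0"
    and ab: "1 \<le> a" "a < b" "b \<le> n + 1"
  shows "0 \<le> (\<Sum>i\<in>{a..<b}. check_loss \<tau> (y i - fitted n \<beta> i - h)
                            - check_loss \<tau> (y i - fitted n \<beta> i)) + 2 * real n * l * \<bar>h\<bar>"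
proof -
  let ?\<beta>' = "shift_block a b h \<beta>"
  let ?d = "\<lambda>i. check_loss \<tau> (y i - fitted n \<beta> i - h) - check_loss \<tau> (y i - fitted n \<beta> i)"
  have "qlasso_objective \<tau> n l y \<beta> \<le> qlasso_objective \<tau> n l y ?\<beta>'"
    using sol unfolding qlasso_solution_def is_arg_min_linorder by blast
  moreover have "(\<Sum>i=1..n. check_loss \<tau> (y i - fitted n ?\<beta>' i))
      - (\<Sum>i=1..n. check_loss \<tau> (y i - fitted n \<beta> i)) = (\<Sum>i\<in>{a..<b}. ?d i)"
  proof -
    have "(\<Sum>i=1..n. check_loss \<tau> (y i - fitted n ?\<beta>' i))
      - (\<Sum>i=1..n. check_loss \<tau> (y i - fitted n \<beta> i))
      = (\<Sum>i=1..n. check_loss \<tau> (y i - fitted n ?\<beta>' i) - check_loss \<tau> (y i - fitted n \<beta> i))"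
      by (simp add: sum_subtractf)
    also have "\<dots> = (\<Sum>i\<in>{a..<b}. ?d i)"
      using ab by (intro sum.mono_neutral_cong_right)
        (auto simp: fitted_shift_block algebra_simps)
    finally show ?thesis .
  qed
  moreover have "real n * l * (\<Sum>j=2..n. \<bar>?\<beta>' j\<bar>)
      \<le> real n * l * ((\<Sum>j=2..n. \<bar>\<beta> j\<bar>) + 2 * \<bar>h\<bar>)"
    using l by (intro mult_left_mono sum_abs_shift_block_le) auto
  ultimately show ?thesis
    unfolding qlasso_objective_def by (simp add: algebra_simps)
qed

text \<open>
This plays the role of the first-order optimality conditions: apart from the slack \<open>h\<close> and the price of
two jumps, the fit on a block behaves like a \<open>\<tau>\<close>-quantile of the observations there. Dividing
the inequality for a block shift of size \<open>h\<close> by \<open>h\<close> turns losses into counts.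
\<close>

lemma qlasso_block_counts:
  assumes sol: "qlasso_solution \<tau> n l y \<beta>" and l: "l \<ge> 0"
    and ab: "1 \<le> a" "a < b" "b \<le> n + 1" and h: "h > 0"
  shows "\<tau> * real (b - a) - 2 * real n * l
           \<le> real (card {i \<in> {a..<b}. y i < fitted n \<beta> i + h})"
    and "real (card {i \<in> {a..<b}. y i < fitted n \<beta> i - h})
           \<le> \<tau> * real (b - a) + 2 * real n * l"
proof -
  let ?r = "\<lambda>i. y i - fitted n \<beta> i"
  have count: "(\<Sum>i\<in>{a..<b}. of_bool (P i)) = real (card {i \<in> {a..<b}. P i})" for P
    by (simp add: of_bool_def sum.If_cases Int_def)
  have "0 \<le> (\<Sum>i\<in>{a..<b}. check_loss \<tau> (?r i - h) - check_loss \<tau> (?r i))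
              + 2 * real n * l * \<bar>h\<bar>"
    by (rule qlasso_block_optimality[OF sol l ab])
  also have "\<dots> \<le> (\<Sum>i\<in>{a..<b}. h * (of_bool (?r i < h) - \<tau>)) + 2 * real n * l * \<bar>h\<bar>"
    by (intro add_right_mono sum_mono check_loss_shift_up h)
  also have "\<dots> = h * (real (card {i \<in> {a..<b}. ?r i < h}) - \<tau> * real (b - a) + 2 * real n * l)"
    using h by (simp add: sum_subtractf count algebra_simps flip: sum_distrib_left)
  finally have "0 \<le> real (card {i \<in> {a..<b}. ?r i < h}) - \<tau> * real (b - a) + 2 * real n * l"
    using h by (simp add: zero_le_mult_iff)
  moreover have "{i \<in> {a..<b}. ?r i < h} = {i \<in> {a..<b}. y i < fitted n \<beta> i + h}"
    by auto
  ultimately show "\<tau> * real (b - a) - 2 * real n * l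
      \<le> real (card {i \<in> {a..<b}. y i < fitted n \<beta> i + h})"
    by simp
  have "0 \<le> (\<Sum>i\<in>{a..<b}. check_loss \<tau> (?r i - (- h)) - check_loss \<tau> (?r i))
              + 2 * real n * l * \<bar>- h\<bar>"
    by (rule qlasso_block_optimality[OF sol l ab])
  also have "\<dots> = (\<Sum>i\<in>{a..<b}. check_loss \<tau> (?r i + h) - check_loss \<tau> (?r i))
              + 2 * real n * l * \<bar>h\<bar>"
    by simp
  also have "\<dots> \<le> (\<Sum>i\<in>{a..<b}. h * (\<tau> - of_bool (?r i < - h))) + 2 * real n * l * \<bar>h\<bar>"
    by (intro add_right_mono sum_mono check_loss_shift_down h)
  also have "\<dots> = h * (\<tau> * real (b - a) - real (card {i \<in> {a..<b}. ?r i < - h}) + 2 * real n * l)"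
    using h by (simp add: sum_subtractf count algebra_simps flip: sum_distrib_left)
  finally have "0 \<le> \<tau> * real (b - a) - real (card {i \<in> {a..<b}. ?r i < - h}) + 2 * real n * l"
    using h by (simp add: zero_le_mult_iff)
  moreover have "{i \<in> {a..<b}. ?r i < - h} = {i \<in> {a..<b}. y i < fitted n \<beta> i - h}"
    by auto
  ultimately show "real (card {i \<in> {a..<b}. y i < fitted n \<beta> i - h})
      \<le> \<tau> * real (b - a) + 2 * real n * l"
    by simp
qed

section \<open>A missed change-point forces a deviation of the errors\<close>

text \<open>
The tolerance \<open>r\<close> is an absolute number of observations; optimality will supply
\<open>r = 2 n \<lambda>\<^sub>n\<close>. The two alternatives correspond to a fit that is too high and to one that is too low.
\<close>

definition deviates :: "real \<Rightarrow> real \<Rightarrow> real \<Rightarrow> (nat \<Rightarrow> real) \<Rightarrow> nat set \<Rightarrow> bool" where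
  "deviates \<tau> r \<eta> e W \<longleftrightarrow>
     real (card {i \<in> W. e i < \<eta>}) \<le> \<tau> * real (card W) + r \<or>
     \<tau> * real (card W) - r \<le> real (card {i \<in> W. e i < - \<eta>})"

text \<open>
Half of the distance \<open>2 \<eta>\<close> between fit and truth is spent on the shift in the optimality condition; the
other half remains as the threshold for the errors.
\<close>

lemma deviates_if_constant_fit_is_off:
  assumes sol: "qlasso_solution \<tau> n l y \<beta>" and l: "l \<ge> 0"
    and ab: "1 \<le> a" "a < b" "b \<le> n + 1" and \<eta>: "\<eta> > 0"
    and fit: "\<And>i. i \<in> {a..<b} \<Longrightarrow> fitted n \<beta> i = c"
    and y: "\<And>i. i \<in> {a..<b} \<Longrightarrow> y i = u + e i"
    and off: "2 * \<eta> \<le> \<bar>c - u\<bar>"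
  shows "deviates \<tau> (2 * real n * l) \<eta> e {a..<b}"
proof (cases "c \<ge> u")
  case True
  have "card {i \<in> {a..<b}. e i < \<eta>} \<le> card {i \<in> {a..<b}. y i < fitted n \<beta> i - \<eta>}"
    using True off by (intro card_mono) (auto simp: fit y)
  with qlasso_block_counts(2)[OF sol l ab \<eta>] show ?thesis
    by (auto simp: deviates_def)
next
  case False
  have "card {i \<in> {a..<b}. y i < fitted n \<beta> i + \<eta>} \<le> card {i \<in> {a..<b}. e i < - \<eta>}"
    using False off by (intro card_mono) (auto simp: fit y)
  with qlasso_block_counts(1)[OF sol l ab \<eta>] show ?thesis
    by (auto simp: deviates_def)
qed

lemma fitted_eq_if_no_jump:
  assumes "a \<le> i" "i \<le> n" "\<And>j. a < j \<Longrightarrow> j \<le> i \<Longrightarrow> \<beta> j = 0"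
  shows "fitted n \<beta> i = fitted n \<beta> a"
proof -
  have "(\<Sum>j=1..i. \<beta> j) = (\<Sum>j=1..a. \<beta> j)"
    using assms by (intro sum.mono_neutral_right) auto
  with assms show ?thesis
    by (simp add: fitted_eq_partial_sum)
qed

text \<open>
A single constant cannot be close to both levels of a jump, so it is off on at least one side.
\<close>

lemma deviates_if_jump_missed:
  assumes sol: "qlasso_solution \<tau> n l y \<beta>" and l: "l \<ge> 0"
    and sm: "m < s" "s + m \<le> n + 1" "0 < m" and \<eta>: "\<eta> > 0"
    and no_jump: "estimated_change_points n \<beta> \<inter> {s - m<..<s + m} = {}"
    and y_left: "\<And>i. i \<in> {s - m..<s} \<Longrightarrow> y i = u + e i"
    and y_right: "\<And>i. i \<in> {s..<s + m} \<Longrightarrow> y i = v + e i"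
    and jump: "4 * \<eta> \<le> \<bar>v - u\<bar>"
  shows "deviates \<tau> (2 * real n * l) \<eta> e {s - m..<s} \<or>
         deviates \<tau> (2 * real n * l) \<eta> e {s..<s + m}"
proof -
  define c where "c = fitted n \<beta> (s - m)"
  have zero: "\<beta> j = 0" if "j \<in> {s - m<..<s + m}" for j
  proof -
    have "j \<in> {2..n}" "j \<notin> estimated_change_points n \<beta>"
      using no_jump that sm by auto
    then show ?thesis
      by (simp add: estimated_change_points_def)
  qed
  have fit: "fitted n \<beta> i = c" if "i \<in> {s - m..<s + m}" for i
    unfolding c_def using that sm by (intro fitted_eq_if_no_jump zero) auto
  have "2 * \<eta> \<le> \<bar>c - u\<bar> \<or> 2 * \<eta> \<le> \<bar>c - v\<bar>"
    using jump by linarith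
  then show ?thesis
  proof
    assume "2 * \<eta> \<le> \<bar>c - u\<bar>"
    then have "deviates \<tau> (2 * real n * l) \<eta> e {s - m..<s}"
      using sm \<eta> y_left
      by (intro deviates_if_constant_fit_is_off[OF sol l, where c = c and u = u] fit) auto
    then show ?thesis ..
  next
    assume "2 * \<eta> \<le> \<bar>c - v\<bar>"
    then have "deviates \<tau> (2 * real n * l) \<eta> e {s..<s + m}"
      using sm \<eta> y_right
      by (intro deviates_if_constant_fit_is_off[OF sol l, where c = c and u = v] fit) auto
    then show ?thesis ..
  qed
qed

lemma obtain_set_missed:
  assumes "finite A" "finite I" "card A < card I" "disjoint_family_on B I"
  obtains k where "k \<in> I" "A \<inter> B k = {}"
proof (rule ccontr)
  assume "\<not> thesis"
  then have "\<forall>k\<in>I. \<exists>x. x \<in> A \<inter> B k"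
    using that by blast
  then obtain g where g: "\<And>k. k \<in> I \<Longrightarrow> g k \<in> A \<inter> B k"
    by metis
  have "inj_on g I"
    using g assms(4) by (fastforce simp: inj_on_def disjoint_family_on_def)
  then have "card I \<le> card A"
    using g assms(1) by (intro card_inj_on_le[of g]) auto
  with assms(3) show False
    by simp
qed

definition change_point_windows :: "nat \<Rightarrow> (nat \<Rightarrow> nat) \<Rightarrow> nat \<Rightarrow> nat set set" where
  "change_point_windows K t m = (\<Union>k\<in>{1..K}. {{t k - m..<t k}, {t k..<t k + m}})"

text \<open>
The whole analytic content of the theorem, for one realization of the errors. The gap condition
includes the boundary phases \<open>k = 0\<close> and \<open>k = K\<close>, so that all windows stay inside \<open>{1..n}\<close>.
\<close>

lemma deviates_if_too_few_change_points:
  assumes loc: "change_point_locations K n t"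
    and model: "piecewise_constant_model K t \<mu> e y"
    and sol: "qlasso_solution \<tau> n l y \<beta>" and l: "l \<ge> 0"
    and gap: "\<And>k. k \<in> {0..K} \<Longrightarrow> t k + 2 * m \<le> t (k + 1)" and m: "0 < m"
    and \<eta>: "\<eta> > 0" and jumps: "\<And>k. k \<in> {1..K} \<Longrightarrow> 4 * \<eta> \<le> \<bar>\<mu> (k + 1) - \<mu> k\<bar>"
    and few: "card (estimated_change_points n \<beta>) < K"
  shows "\<exists>W\<in>change_point_windows K t m. deviates \<tau> (2 * real n * l) \<eta> e W"
proof -
  have sep: "t j + 2 * m \<le> t k" if "j < k" "k \<le> K + 1" for j k
    using that
  proof (induction k)
    case (Suc k)
    then show ?case
      using gap[of k] by (cases "j = k") auto
  qed simp
  have "disjoint_family_on (\<lambda>k. {t k - m<..<t k + m}) {1..K}"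
    unfolding disjoint_family_on_def
  proof (intro ballI impI)
    fix j k assume "j \<in> {1..K}" "k \<in> {1..K}" "j \<noteq> k"
    then have "t j + 2 * m \<le> t k \<or> t k + 2 * m \<le> t j"
      using sep[of j k] sep[of k j] by (auto simp: neq_iff)
    then show "{t j - m<..<t j + m} \<inter> {t k - m<..<t k + m} = {}"
      by auto
  qed
  moreover have "finite (estimated_change_points n \<beta>)"
    by (auto simp: estimated_change_points_def)
  ultimately obtain k where k: "k \<in> {1..K}"
    and missed: "estimated_change_points n \<beta> \<inter> {t k - m<..<t k + m} = {}"
    using few by (auto elim: obtain_set_missed[of _ "{1..K}"])
  have bounds: "m < t k" "t k + m \<le> n + 1"
    using sep[of 0 k] sep[of k "K + 1"] loc k by (auto simp: change_point_locations_def)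
  have y: "y i = \<mu> j + e i" if "j \<in> {1..K+1}" "i \<in> {t (j - 1)..<t j}" for i j
    using model that by (auto simp: piecewise_constant_model_def)
  have "deviates \<tau> (2 * real n * l) \<eta> e {t k - m..<t k} \<or>
        deviates \<tau> (2 * real n * l) \<eta> e {t k..<t k + m}"
  proof (rule deviates_if_jump_missed[OF sol l bounds m \<eta> missed _ _ jumps[OF k]])
    fix i assume "i \<in> {t k - m..<t k}"
    then show "y i = \<mu> k + e i"
      using k sep[of "k - 1" k] by (intro y) auto
  next
    fix i assume "i \<in> {t k..<t k + m}"
    then show "y i = \<mu> (k + 1) + e i"
      using k sep[of k "k + 1"] by (intro y) auto
  qed
  with k show ?thesis
    by (auto simp: change_point_windows_def)
qed

section \<open>Deviations of the errors are improbable\<close>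

definition prob_below :: "(real \<Rightarrow> real) \<Rightarrow> real \<Rightarrow> real" where
  "prob_below f x = measure (density lborel (\<lambda>x. ennreal (f x))) {..<x}"

lemma measure_below_eq_prob_below:
  assumes X: "distributed M lborel X (\<lambda>x. ennreal (f x))"
  shows "measure M {\<omega> \<in> space M. X \<omega> < x} = prob_below f x"
proof -
  have [measurable]: "X \<in> borel_measurable M"
    using distributed_measurable[OF X] by simp
  have "prob_below f x = measure (distr M lborel X) {..<x}"
    by (simp add: prob_below_def distributed_distr_eq_density[OF X])
  also have "\<dots> = measure M {\<omega> \<in> space M. X \<omega> < x}"
    by (subst measure_distr) (auto intro!: arg_cong[where f = "measure M"])
  finally show ?thesis ..
qed

lemma prob_below_strict_mono:
  assumes "prob_space M" and X: "distributed M lborel X (\<lambda>x. ennreal (f x))"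
    and pos: "\<And>x. f x > 0" and "a < b"
  shows "prob_below f a < prob_below f b"
proof -
  interpret prob_space M by fact
  let ?D = "density lborel (\<lambda>x. ennreal (f x))"
  have D: "?D = distr M lborel X"
    by (simp add: distributed_distr_eq_density[OF X])
  interpret D: prob_space ?D
    unfolding D using distributed_measurable[OF X] by (rule prob_space_distr)
  have f: "(\<lambda>x. ennreal (f x)) \<in> borel_measurable lborel"
    using distributed_borel_measurable[OF X] .
  have "emeasure ?D {a..<b} \<noteq> 0"
  proof
    assume "emeasure ?D {a..<b} = 0"
    then have "{a..<b} \<in> null_sets ?D"
      by (simp add: null_sets_def)
    then have "AE x in lborel. x \<in> {a..<b} \<longrightarrow> ennreal (f x) = 0"
      using null_sets_density_iff[OF f] by blast
    then have "AE x in lborel. x \<notin> {a..<b}"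
      by eventually_elim (use pos in \<open>auto simp: ennreal_eq_0_iff simp flip: not_less\<close>)
    then have "emeasure lborel {a..<b} = 0"
      by (subst (asm) AE_iff_measurable[where N = "{a..<b}"]) auto
    with \<open>a < b\<close> show False
      by simp
  qed
  then have "measure ?D {a..<b} > 0"
    by (simp add: D.emeasure_eq_measure zero_less_measure_iff)
  moreover have "measure ?D {..<b} = measure ?D {..<a} + measure ?D {a..<b}"
    using \<open>a < b\<close> by (subst D.finite_measure_Union[symmetric]) (auto simp: ivl_disj_un)
  ultimately show ?thesis
    by (simp add: prob_below_def)
qed

text \<open>Hoeffding's inequality for the indicators of the events \<open>e i < x\<close>.\<close>

lemma count_below_tails:
  fixes e :: "nat \<Rightarrow> 'a \<Rightarrow> real"
  assumes "prob_space M" and indep: "prob_space.indep_vars M (\<lambda>_. borel) e W"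
    and W: "finite W" "W \<noteq> {}"
    and q: "\<And>i. i \<in> W \<Longrightarrow> measure M {\<omega> \<in> space M. e i \<omega> < x} = q" and s: "s \<ge> 0"
  shows "measure M {\<omega> \<in> space M. real (card {i \<in> W. e i \<omega> < x}) \<le> (q - s) * real (card W)}
           \<le> exp (- 2 * s\<^sup>2 * real (card W))" (is ?low)
    and "measure M {\<omega> \<in> space M. (q + s) * real (card W) \<le> real (card {i \<in> W. e i \<omega> < x})}
           \<le> exp (- 2 * s\<^sup>2 * real (card W))" (is ?high)
proof -
  interpret prob_space M by fact
  let ?X = "\<lambda>i \<omega>. of_bool (e i \<omega> < x) :: real"
  have rv: "e i \<in> borel_measurable M" if "i \<in> W" for i
    using indep that by (auto simp: indep_vars_def)
  have E: "expectation (?X i) = q" if "i \<in> W" for i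
  proof -
    note [measurable] = rv[OF that]
    have "expectation (?X i) = expectation (indicator {\<omega> \<in> space M. e i \<omega> < x})"
      by (intro Bochner_Integration.integral_cong) (auto simp: indicator_def)
    also have "\<dots> = q"
      using q[OF that] by simp
    finally show ?thesis .
  qed
  have indepX: "indep_vars (\<lambda>_. borel) ?X W"
    by (rule indep_vars_compose2[OF indep]) simp
  interpret H: Hoeffding_ineq M W ?X "\<lambda>_. 0" "\<lambda>_. 1" "real (card W) * q"
  proof unfold_locales
    show "real (card W) * q \<equiv> \<Sum>i\<in>W. expectation (?X i)"
      using E by (intro eq_reflection) simp
  qed (use W indepX in auto)
  have count: "(\<Sum>i\<in>W. ?X i \<omega>) = real (card {i \<in> W. e i \<omega> < x})" for \<omega>
    using W by (simp add: of_bool_def sum.If_cases Int_def)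
  have card: "real (card W) > 0"
    using W by (simp add: card_gt_0_iff)
  have expo: "- 2 * (s * real (card W))\<^sup>2 / (\<Sum>i\<in>W. (1 - 0)\<^sup>2) = - 2 * s\<^sup>2 * real (card W)"
    using card by (simp add: power2_eq_square)
  show ?low
    using H.Hoeffding_ineq_le[of "s * real (card W)"] s card
    unfolding count expo by (simp add: algebra_simps)
  show ?high
    using H.Hoeffding_ineq_ge[of "s * real (card W)"] s card
    unfolding count expo by (simp add: algebra_simps)
qed

text \<open>
The distance \<open>2 s\<close> between \<open>\<tau>\<close> and the probabilities at \<open>\<plusminus> \<eta>\<close> is split evenly: one \<open>s\<close> absorbs
the tolerance \<open>r\<close>, the other is left for Hoeffding's inequality.
\<close>

lemma prob_deviates_le:
  assumes M: "prob_space M" and indep: "prob_space.indep_vars M (\<lambda>_. borel) e W"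
    and W: "finite W" "W \<noteq> {}"
    and distr: "\<And>i. i \<in> W \<Longrightarrow> distributed M lborel (e i) (\<lambda>x. ennreal (f x))"
    and s: "s \<ge> 0" "\<tau> + 2 * s \<le> prob_below f \<eta>" "prob_below f (- \<eta>) \<le> \<tau> - 2 * s"
    and r: "r \<le> s * real (card W)"
  shows "{\<omega> \<in> space M. deviates \<tau> r \<eta> (\<lambda>i. e i \<omega>) W} \<in> sets M"
    and "measure M {\<omega> \<in> space M. deviates \<tau> r \<eta> (\<lambda>i. e i \<omega>) W}
           \<le> 2 * exp (- 2 * s\<^sup>2 * real (card W))"
proof -
  interpret prob_space M by fact
  have rv: "e i \<in> borel_measurable M" if "i \<in> W" for i
    using distributed_measurable[OF distr[OF that]] by simp
  have count: "real (card {i \<in> W. e i \<omega> < x}) = (\<Sum>i\<in>W. of_bool (e i \<omega> < x))" for \<omega> x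
    using W by (simp add: of_bool_def sum.If_cases Int_def)
  have [measurable]: "(\<lambda>\<omega>. real (card {i \<in> W. e i \<omega> < x})) \<in> borel_measurable M" for x
    unfolding count using rv by measurable
  show "{\<omega> \<in> space M. deviates \<tau> r \<eta> (\<lambda>i. e i \<omega>) W} \<in> sets M"
    unfolding deviates_def by measurable
  let ?A = "{\<omega> \<in> space M. real (card {i \<in> W. e i \<omega> < \<eta>}) \<le> (prob_below f \<eta> - s) * real (card W)}"
  let ?B = "{\<omega> \<in> space M. (prob_below f (- \<eta>) + s) * real (card W) \<le> real (card {i \<in> W. e i \<omega> < - \<eta>})}"
  have A: "\<tau> * real (card W) + r \<le> (prob_below f \<eta> - s) * real (card W)"
    using r mult_right_mono[OF s(2), of "real (card W)"] by (simp add: algebra_simps)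
  have B: "(prob_below f (- \<eta>) + s) * real (card W) \<le> \<tau> * real (card W) - r"
    using r mult_right_mono[OF s(3), of "real (card W)"] by (simp add: algebra_simps)
  have "measure M {\<omega> \<in> space M. deviates \<tau> r \<eta> (\<lambda>i. e i \<omega>) W} \<le> measure M (?A \<union> ?B)"
    using A B by (intro finite_measure_mono) (auto simp: deviates_def)
  also have "\<dots> \<le> measure M ?A + measure M ?B"
    by (intro measure_Un_le) measurable
  also have "\<dots> \<le> exp (- 2 * s\<^sup>2 * real (card W)) + exp (- 2 * s\<^sup>2 * real (card W))"
    using distr by (intro add_mono count_below_tails[OF M indep W _ s(1)] measure_below_eq_prob_below)
  finally show "measure M {\<omega> \<in> space M. deviates \<tau> r \<eta> (\<lambda>i. e i \<omega>) W}
      \<le> 2 * exp (- 2 * s\<^sup>2 * real (card W))"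
    by simp
qed

section \<open>The probability of too few change-points\<close>

text \<open>
A union bound over the \<open>2 K\<close> windows, each of which can deviate in two ways. The windows depend only on
the true locations, so that they are the same for every realization of the errors.
\<close>

lemma prob_too_few_change_points_le:
  fixes e y :: "nat \<Rightarrow> 'a \<Rightarrow> real"
  assumes M: "prob_space M"
    and loc: "change_point_locations K n t"
    and model: "\<And>\<omega>. \<omega> \<in> space M \<Longrightarrow>
      piecewise_constant_model K t \<mu> (\<lambda>i. e i \<omega>) (\<lambda>i. y i \<omega>)"
    and sol: "\<And>\<omega>. \<omega> \<in> space M \<Longrightarrow> qlasso_solution \<tau> n l (\<lambda>i. y i \<omega>) (\<beta> \<omega>)"
    and l: "l \<ge> 0" and errors: "iid_errors M \<tau> f n e"
    and gap: "\<And>k. k \<in> {0..K} \<Longrightarrow> t k + 2 * m \<le> t (k + 1)" and m: "0 < m"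
    and \<eta>: "\<eta> > 0" and jumps: "\<And>k. k \<in> {1..K} \<Longrightarrow> 4 * \<eta> \<le> \<bar>\<mu> (k + 1) - \<mu> k\<bar>"
    and s: "s \<ge> 0" "\<tau> + 2 * s \<le> prob_below f \<eta>" "prob_below f (- \<eta>) \<le> \<tau> - 2 * s"
    and r: "2 * real n * l \<le> s * real m"
  shows "measure M {\<omega> \<in> space M. card (estimated_change_points n (\<beta> \<omega>)) < K}
           \<le> 4 * real K * exp (- 2 * s\<^sup>2 * real m)"
proof -
  interpret prob_space M by fact
  let ?dev = "\<lambda>W. {\<omega> \<in> space M. deviates \<tau> (2 * real n * l) \<eta> (\<lambda>i. e i \<omega>) W}"
  have sub: "W \<subseteq> {1..n} \<and> card W = m" if W: "W \<in> change_point_windows K t m" for W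
  proof -
    obtain k where k: "k \<in> {1..K}" and W: "W = {t k - m..<t k} \<or> W = {t k..<t k + m}"
      using W by (auto simp: change_point_windows_def)
    have mono: "strict_mono_on {0..K} t" "t 0 = 1" "t (K + 1) = n + 1" "t K < n"
      using loc by (auto simp: change_point_locations_def)
    have "t 0 \<le> t (k - 1)"
      using strict_mono_on_leD[OF mono(1), of 0 "k - 1"] k by auto
    moreover have "t (k + 1) \<le> n + 1"
      using strict_mono_on_leD[OF mono(1), of "k + 1" K] mono k by (cases "k = K") auto
    ultimately show ?thesis
      using gap[of "k - 1"] gap[of k] k W mono(2) by force
  qed
  have fin: "finite (change_point_windows K t m)"
    by (simp add: change_point_windows_def)
  have card_windows: "card (change_point_windows K t m) \<le> 2 * K"
  proof -
    have "card (change_point_windows K t m) \<le> (\<Sum>k\<in>{1..K}. card {{t k - m..<t k}, {t k..<t k + m}})"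
      unfolding change_point_windows_def by (rule card_UN_le) simp
    also have "\<dots> \<le> (\<Sum>k\<in>{1..K}. 2)"
      by (intro sum_mono) (simp add: card_insert_if)
    finally show ?thesis by simp
  qed
  have dev: "?dev W \<in> sets M \<and> measure M (?dev W) \<le> 2 * exp (- 2 * s\<^sup>2 * real m)"
    if "W \<in> change_point_windows K t m" for W
  proof -
    have W: "W \<subseteq> {1..n}" "card W = m"
      using sub[OF that] by auto
    then have "finite W" "W \<noteq> {}"
      using m by (auto intro: finite_subset)
    moreover have "indep_vars (\<lambda>_. borel) e W"
      using errors W by (auto simp: iid_errors_def intro: indep_vars_subset)
    moreover have "distributed M lborel (e i) (\<lambda>x. ennreal (f x))" if "i \<in> W" for i
      using errors W that by (auto simp: iid_errors_def)
    ultimately show ?thesis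
      using prob_deviates_le[OF M, of e W f s \<tau> \<eta> "2 * real n * l"] s r W by auto
  qed
  have "measure M {\<omega> \<in> space M. card (estimated_change_points n (\<beta> \<omega>)) < K}
      \<le> measure M (\<Union>W\<in>change_point_windows K t m. ?dev W)"
  proof (intro finite_measure_mono)
    show "{\<omega> \<in> space M. card (estimated_change_points n (\<beta> \<omega>)) < K}
        \<subseteq> (\<Union>W\<in>change_point_windows K t m. ?dev W)"
      using deviates_if_too_few_change_points[OF loc model sol l gap m \<eta> jumps] by blast
  qed (use dev fin in auto)
  also have "\<dots> \<le> (\<Sum>W\<in>change_point_windows K t m. measure M (?dev W))"
    using dev fin by (intro finite_measure_subadditive_finite) auto
  also have "\<dots> \<le> (\<Sum>W\<in>change_point_windows K t m. 2 * exp (- 2 * s\<^sup>2 * real m))"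
    using dev by (intro sum_mono) auto
  also have "\<dots> = 2 * real (card (change_point_windows K t m)) * exp (- 2 * s\<^sup>2 * real m)"
    by simp
  also have "\<dots> \<le> 2 * real (2 * K) * exp (- 2 * s\<^sup>2 * real m)"
    using card_windows by (intro mult_right_mono mult_left_mono of_nat_mono) auto
  finally show ?thesis by simp
qed

text \<open>The element 1 takes care of an empty index set, which arises for \<open>K = 0\<close>.\<close>

lemma finite_positive_lower_bound:
  fixes g :: "'b \<Rightarrow> real"
  assumes "finite S" "\<And>x. x \<in> S \<Longrightarrow> g x > 0"
  shows "\<exists>c>0. \<forall>x\<in>S. c \<le> g x"
proof (intro exI conjI ballI)
  show "Min (insert 1 (g ` S)) > 0"
    using assms by (subst Min_gr_iff) auto
  show "Min (insert 1 (g ` S)) \<le> g x" if "x \<in> S" for x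
    using assms(1) that by (intro Min_le) auto
qed

lemma eventually_linear_gaps:
  fixes t :: "nat \<Rightarrow> nat \<Rightarrow> nat" and \<theta> :: "nat \<Rightarrow> real"
  assumes loc: "\<And>n. n \<ge> n0 \<Longrightarrow> change_point_locations K n (t n)"
    and limits: "\<And>k. k \<in> {1..K} \<Longrightarrow> (\<lambda>n. real (t n k) / real n) \<longlonglongrightarrow> \<theta> k"
    and theta: "strict_mono_on {1..K} \<theta>" "\<And>k. k \<in> {1..K} \<Longrightarrow> 0 < \<theta> k \<and> \<theta> k < 1"
  obtains \<kappa> where "\<kappa> > 0"
    "\<forall>\<^sub>F n in sequentially. \<forall>k\<in>{0..K}. t n k + 2 * nat \<lfloor>\<kappa> * real n\<rfloor> \<le> t n (k + 1)"
proof -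
  \<comment> \<open>The conventional locations \<open>t 0 = 1\<close> and \<open>t (K + 1) = n + 1\<close> have relative limits 0 and 1,
      so the first and the last phase are treated like the inner ones.\<close>
  define \<Theta> where "\<Theta> k = (if k = 0 then 0 else if k \<le> K then \<theta> k else 1)" for k
  have lim: "(\<lambda>n. real (t n k) / real n) \<longlonglongrightarrow> \<Theta> k" if "k \<le> K + 1" for k
  proof -
    have loc': "\<forall>\<^sub>F n in sequentially. change_point_locations K n (t n)"
      using loc eventually_sequentially by blast
    consider "k = 0" | "k \<in> {1..K}" | "k = K + 1"
      using \<open>k \<le> K + 1\<close> by fastforce
    then show ?thesis
    proof cases
      case 1
      have "(\<lambda>n. 1 / real n) \<longlonglongrightarrow> 0"
        by (rule lim_1_over_n)
      moreover have "\<forall>\<^sub>F n in sequentially. 1 / real n = real (t n k) / real n"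
        using loc' by eventually_elim (simp add: 1 change_point_locations_def)
      ultimately show ?thesis
        using 1 by (simp add: \<Theta>_def tendsto_cong)
    next
      case 2
      then show ?thesis
        using limits by (simp add: \<Theta>_def)
    next
      case 3
      have "(\<lambda>n. 1 + 1 / real n) \<longlonglongrightarrow> 1 + 0"
        by (intro tendsto_intros lim_1_over_n)
      moreover have "\<forall>\<^sub>F n in sequentially. 1 + 1 / real n = real (t n k) / real n"
        using loc' eventually_gt_at_top[of 0]
        by eventually_elim (simp add: 3 change_point_locations_def field_simps)
      ultimately show ?thesis
        using 3 by (simp add: \<Theta>_def tendsto_cong)
    qed
  qed
  have "\<Theta> (k + 1) - \<Theta> k > 0" if "k \<in> {0..K}" for k
    using that theta strict_mono_onD[OF theta(1), of k "k + 1"]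
    by (cases "k = 0"; cases "k = K") (auto simp: \<Theta>_def)
  then obtain c where c: "c > 0" "\<And>k. k \<in> {0..K} \<Longrightarrow> c \<le> \<Theta> (k + 1) - \<Theta> k"
    using finite_positive_lower_bound[of "{0..K}" "\<lambda>k. \<Theta> (k + 1) - \<Theta> k"] by blast
  \<comment> \<open>Two windows per gap account for one factor 2 in 4; the other makes the gap exceed
      its bound strictly in the limit.\<close>
  show ?thesis
  proof (rule that)
    show "c / 4 > 0"
      using c by simp
    have "\<forall>\<^sub>F n in sequentially. t n k + 2 * nat \<lfloor>c / 4 * real n\<rfloor> \<le> t n (k + 1)"
      if k: "k \<in> {0..K}" for k
    proof -
      have "(\<lambda>n. real (t n (k + 1)) / real n - real (t n k) / real n) \<longlonglongrightarrow> \<Theta> (k + 1) - \<Theta> k"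
        using k by (intro tendsto_diff lim) auto
      moreover have "c / 2 < \<Theta> (k + 1) - \<Theta> k"
        using c(1) c(2)[OF k] by linarith
      ultimately have "\<forall>\<^sub>F n in sequentially.
          c / 2 < real (t n (k + 1)) / real n - real (t n k) / real n"
        by (rule order_tendstoD)
      then show ?thesis
        using eventually_gt_at_top[of 0]
      proof eventually_elim
        case (elim n)
        then have "real (t n k) + 2 * (c / 4 * real n) \<le> real (t n (k + 1))"
          by (simp add: field_simps)
        moreover have "real (nat \<lfloor>c / 4 * real n\<rfloor>) \<le> c / 4 * real n"
          using c by (intro of_nat_floor) simp
        ultimately have "real (t n k + 2 * nat \<lfloor>c / 4 * real n\<rfloor>) \<le> real (t n (k + 1))"
          by simp
        then show ?case
          by (rule of_nat_le_iff[THEN iffD1])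
      qed
    qed
    then show "\<forall>\<^sub>F n in sequentially.
        \<forall>k\<in>{0..K}. t n k + 2 * nat \<lfloor>c / 4 * real n\<rfloor> \<le> t n (k + 1)"
      by (intro eventually_ball_finite) auto
  qed
qed

theorem theorem3p3:
  fixes M :: "'a measure"
    and \<tau> C :: real
    and K n0 :: nat
    and t :: "nat \<Rightarrow> nat \<Rightarrow> nat"
    and \<mu> \<theta> :: "nat \<Rightarrow> real"
    and f :: "real \<Rightarrow> real"
    and \<epsilon> Y :: "nat \<Rightarrow> nat \<Rightarrow> 'a \<Rightarrow> real"
    and \<beta> :: "nat \<Rightarrow> 'a \<Rightarrow> nat \<Rightarrow> real"
    and lam \<delta> :: "nat \<Rightarrow> real"
  assumes prob: "prob_space M"
    and quantile_level: "0 < \<tau>" "\<tau> < 1"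
    and locations: "\<And>n. n \<ge> n0 \<Longrightarrow> change_point_locations K n (t n)"
    and jumps: "\<And>k. k \<in> {1..K} \<Longrightarrow> \<mu> k \<noteq> \<mu> (k + 1)"
    and model: "\<And>n \<omega>. n \<ge> n0 \<Longrightarrow> \<omega> \<in> space M \<Longrightarrow>
        piecewise_constant_model K (t n) \<mu> (\<lambda>i. \<epsilon> n i \<omega>) (\<lambda>i. Y n i \<omega>)"
    and lam_pos: "\<And>n. n \<ge> n0 \<Longrightarrow> lam n > 0"
    and estimator_measurable: "\<And>n i. n \<ge> n0 \<Longrightarrow> i \<in> {1..n} \<Longrightarrow>
        (\<lambda>\<omega>. \<beta> n \<omega> i) \<in> borel_measurable M"
    and estimator: "\<And>n \<omega>. n \<ge> n0 \<Longrightarrow> \<omega> \<in> space M \<Longrightarrow>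
        qlasso_solution \<tau> n (lam n) (\<lambda>i. Y n i \<omega>) (\<beta> n \<omega>)"
    and density: "error_density f"
    and errors: "\<And>n. n \<ge> n0 \<Longrightarrow> iid_errors M \<tau> f n (\<epsilon> n)"
    and delta: "decseq \<delta>" "\<And>n. \<delta> n > 0" "\<delta> \<longlonglongrightarrow> 0"
    and phase_length: "\<And>n. n \<ge> n0 \<Longrightarrow> min_phase_length K (t n) \<ge> real n * \<delta> n"
    and lam_delta: "(\<lambda>n. lam n / \<delta> n) \<longlonglongrightarrow> 0"
    and C_pos: "C > 0"
    and lam_eq: "\<And>n. n \<ge> n0 \<Longrightarrow> lam n = C * sqrt (ln (real n) / real n)"
    and limits: "\<And>k. k \<in> {1..K} \<Longrightarrow> (\<lambda>n. real (t n k) / real n) \<longlonglongrightarrow> \<theta> k"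
    and theta: "strict_mono_on {1..K} \<theta>" "\<And>k. k \<in> {1..K} \<Longrightarrow> 0 < \<theta> k \<and> \<theta> k < 1"
  shows "(\<lambda>n. measure M {\<omega> \<in> space M. card (estimated_change_points n (\<beta> n \<omega>)) < K})
           \<longlonglongrightarrow> 0"
proof -
  have pos: "\<And>x. f x > 0"
    using density by (simp add: error_density_def)
  have "0 < \<bar>\<mu> (k + 1) - \<mu> k\<bar> / 4" if "k \<in> {1..K}" for k
    using jumps[OF that] by simp
  then obtain \<eta> where \<eta>: "\<eta> > 0" "\<And>k. k \<in> {1..K} \<Longrightarrow> \<eta> \<le> \<bar>\<mu> (k + 1) - \<mu> k\<bar> / 4"
    using finite_positive_lower_bound[of "{1..K}" "\<lambda>k. \<bar>\<mu> (k + 1) - \<mu> k\<bar> / 4"] by blast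
  obtain X where X: "distributed M lborel X (\<lambda>x. ennreal (f x))"
      "measure M {\<omega> \<in> space M. X \<omega> < 0} = \<tau>"
    using errors[of "Suc n0"] by (fastforce simp: iid_errors_def)
  have \<tau>: "prob_below f 0 = \<tau>"
    using measure_below_eq_prob_below[OF X(1), of 0] X(2) by simp
  define s where "s = min (prob_below f \<eta> - \<tau>) (\<tau> - prob_below f (- \<eta>)) / 2"
  have s: "s > 0"
    using prob_below_strict_mono[OF prob X(1) pos, of 0 \<eta>]
      prob_below_strict_mono[OF prob X(1) pos, of "- \<eta>" 0] \<eta>(1) by (simp add: s_def \<tau>)
  have s_le: "\<tau> + 2 * s \<le> prob_below f \<eta>" "prob_below f (- \<eta>) \<le> \<tau> - 2 * s"
    by (simp_all add: s_def)
  obtain \<kappa> where \<kappa>: "\<kappa> > 0" and gaps: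
    "\<forall>\<^sub>F n in sequentially. \<forall>k\<in>{0..K}. t n k + 2 * nat \<lfloor>\<kappa> * real n\<rfloor> \<le> t n (k + 1)"
    using eventually_linear_gaps[OF locations limits theta] by blast
  define m where "m n = nat \<lfloor>\<kappa> * real n\<rfloor>" for n
  have m_top: "filterlim m at_top sequentially"
    unfolding m_def using \<kappa>
    by (intro filterlim_compose[OF filterlim_nat_sequentially]
        filterlim_compose[OF filterlim_floor_sequentially]
        filterlim_tendsto_pos_mult_at_top[OF tendsto_const _ filterlim_real_sequentially])
  have "(\<lambda>n. lam n / \<delta> n * \<delta> n) \<longlonglongrightarrow> 0 * 0"
    by (intro tendsto_mult lam_delta delta(3))
  then have "lam \<longlonglongrightarrow> 0"
    using delta(2) by (simp add: less_imp_neq[symmetric])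
  then have "\<forall>\<^sub>F n in sequentially. lam n < s * \<kappa> / 4"
    using s \<kappa> by (intro order_tendstoD) auto
  moreover have "\<forall>\<^sub>F n in sequentially. m n > 0"
    using eventually_compose_filterlim[OF eventually_gt_at_top m_top] .
  moreover have "\<forall>\<^sub>F n in sequentially. real n \<ge> 2 / \<kappa>"
    using filterlim_real_sequentially by (simp add: filterlim_at_top)
  ultimately have bound: "\<forall>\<^sub>F n in sequentially.
      measure M {\<omega> \<in> space M. card (estimated_change_points n (\<beta> n \<omega>)) < K}
        \<le> 4 * real K * exp (- 2 * s\<^sup>2 * real (m n))"
    using gaps eventually_ge_at_top[of n0]
  proof eventually_elim
    case (elim n)
    have "\<kappa> * real n - 1 \<le> real (m n)"
      unfolding m_def by linarith
    moreover have "\<kappa> * real n \<ge> 2"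
      using elim(3) \<kappa> by (simp add: field_simps)
    ultimately have m_ge: "\<kappa> * real n / 2 \<le> real (m n)"
      by linarith
    have "2 * real n * lam n \<le> 2 * real n * (s * \<kappa> / 4)"
      using elim(1) by (intro mult_left_mono) auto
    also have "\<dots> = s * (\<kappa> * real n / 2)"
      by simp
    also have "\<dots> \<le> s * real (m n)"
      using m_ge s by (intro mult_left_mono) auto
    finally have lam_bound: "2 * real n * lam n \<le> s * real (m n)" .
    have gap: "t n k + 2 * m n \<le> t n (k + 1)" if "k \<in> {0..K}" for k
      using elim(4) that by (auto simp: m_def)
    have jump: "4 * \<eta> \<le> \<bar>\<mu> (k + 1) - \<mu> k\<bar>" if "k \<in> {1..K}" for k
      using \<eta>(2)[OF that] by simp
    show ?case
      by (rule prob_too_few_change_points_le[where e = "\<epsilon> n" and y = "Y n" and t = "t n"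
            and \<mu> = \<mu> and \<beta> = "\<beta> n" and l = "lam n" and \<eta> = \<eta> and \<tau> = \<tau> and f = f,
            OF prob locations[OF elim(5)] model[OF elim(5)] estimator[OF elim(5)]
              less_imp_le[OF lam_pos[OF elim(5)]] errors[OF elim(5)] gap elim(2) \<eta>(1) jump
              less_imp_le[OF s] s_le lam_bound])
  qed
  have "filterlim (\<lambda>n. real (m n)) at_top sequentially"
    by (rule filterlim_compose[OF filterlim_real_sequentially m_top])
  then have "filterlim (\<lambda>n. - 2 * s\<^sup>2 * real (m n)) at_bot sequentially"
    using s by (intro filterlim_tendsto_neg_mult_at_bot[OF tendsto_const]) auto
  then have "(\<lambda>n. exp (- 2 * s\<^sup>2 * real (m n))) \<longlonglongrightarrow> 0"
    by (rule filterlim_compose[OF exp_at_bot])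
  then have "(\<lambda>n. 4 * real K * exp (- 2 * s\<^sup>2 * real (m n))) \<longlonglongrightarrow> 0"
    by (rule tendsto_mult_right_zero)
  then show ?thesis
    by (rule tendsto_sandwich[OF _ bound tendsto_const, rotated]) simp
qed

end
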